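(* Let $G$ be a countable group and let $A$ be a subset of $G$. Then $A$ is disparse if and only if each ultrafilter $p\in A^*$ is right cancelable in $\beta G$.
   Context: $G$ is a discrete group. $\beta G$ is the Stone-Čech compactification of $G$, whose points are the ultrafilters on $G$ (points of $G$ being identified with principal ultrafilters), with base of open sets $\overline{A}=\{p\in\beta G: A\in p\}$, $A\subseteq G$. $G^*=\beta G\setminus G$ is the set of free ultrafilters on $G$, and $A^*=\overline{A}\cap G^*$ for $A\subseteq G$. $\beta G$ is a semigroup under the product defined by: for $A\subseteq G$, $A\in pq$ if and only if $\{g\in G: g^{-1}A\in q\}\in p$. For $p\in\beta G$, $Gp=\{gp:g\in G\}$. For $A\subseteq G$ and $p\in G^*$, the $p$-companion of $A$ is $\Delta_p(A)=A^*\cap Gp=\{gp: g\in G,\ A\in gp\}$. A subset $A$ of $G$ is disparse if, for every $p\in G^*$, $\Delta_p(A)$ is discrete (as a subspace of $\beta G$). An element $s$ of a semigroup $S$ is right cancelable if, for any $x,y\in S$, $xs=ys$ implies $x=y$. *)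

theory Defs
  imports "HOL-Analysis.Analysis" "HOL-Algebra.Coset"
begin

definition ultrafilter_on :: "'a set \<Rightarrow> 'a set set \<Rightarrow> bool" where
  "ultrafilter_on X p \<longleftrightarrow>
     p \<subseteq> Pow X \<and> X \<in> p \<and> {} \<notin> p \<and>
     (\<forall>A\<in>p. \<forall>B\<in>p. A \<inter> B \<in> p) \<and>
     (\<forall>A\<in>p. \<forall>B. A \<subseteq> B \<and> B \<subseteq> X \<longrightarrow> B \<in> p) \<and>
     (\<forall>A. A \<subseteq> X \<longrightarrow> A \<in> p \<or> X - A \<in> p)"

definition principal_uf :: "'a set \<Rightarrow> 'a \<Rightarrow> 'a set set" where
  "principal_uf X x = {A. A \<subseteq> X \<and> x \<in> A}"

definition beta :: "'a set \<Rightarrow> 'a set set set" where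
  "beta X = {p. ultrafilter_on X p}"

definition beta_remainder :: "'a set \<Rightarrow> 'a set set set" where
  "beta_remainder X = beta X - principal_uf X ` X"

definition beta_closure :: "'a set \<Rightarrow> 'a set \<Rightarrow> 'a set set set" where
  "beta_closure X A = {p \<in> beta X. A \<in> p}"

definition beta_star :: "'a set \<Rightarrow> 'a set \<Rightarrow> 'a set set set" where
  "beta_star X A = beta_closure X A \<inter> beta_remainder X"

text \<open>The generating sets form a base, not merely a subbase: see
  \<open>openin_beta_topology\<close> below.\<close>

definition beta_topology :: "'a set \<Rightarrow> 'a set set topology" where
  "beta_topology X = topology_generated_by {beta_closure X A | A. A \<subseteq> X}"

definition uf_mult :: "('a, 'b) monoid_scheme \<Rightarrow> 'a set set \<Rightarrow> 'a set set \<Rightarrow> 'a set set" where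
  "uf_mult G p q =
     {A. A \<subseteq> carrier G \<and> {g \<in> carrier G. (inv\<^bsub>G\<^esub> g) <#\<^bsub>G\<^esub> A \<in> q} \<in> p}"

definition beta_monoid :: "('a, 'b) monoid_scheme \<Rightarrow> 'a set set monoid" where
  "beta_monoid G =
     \<lparr>carrier = beta (carrier G), mult = uf_mult G, one = principal_uf (carrier G) \<one>\<^bsub>G\<^esub>\<rparr>"

text \<open>A point \<open>g\<close> of \<open>G\<close> acts on \<open>\<beta>G\<close> through its principal ultrafilter; \<open>uf_mult_principal\<close>
  below gives the usual description of \<open>gp\<close>.\<close>

definition uf_orbit :: "('a, 'b) monoid_scheme \<Rightarrow> 'a set set \<Rightarrow> 'a set set set" where
  "uf_orbit G p = {uf_mult G (principal_uf (carrier G) g) p | g. g \<in> carrier G}"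

definition companion :: "('a, 'b) monoid_scheme \<Rightarrow> 'a set set \<Rightarrow> 'a set \<Rightarrow> 'a set set set" where
  "companion G p A = beta_star (carrier G) A \<inter> uf_orbit G p"

definition disparse :: "('a, 'b) monoid_scheme \<Rightarrow> 'a set \<Rightarrow> bool" where
  "disparse G A \<longleftrightarrow>
     (\<forall>p \<in> beta_remainder (carrier G).
        subtopology (beta_topology (carrier G)) (companion G p A)
          = discrete_topology (companion G p A))"

definition right_cancelable :: "('a, 'b) monoid_scheme \<Rightarrow> 'a \<Rightarrow> bool" where
  "right_cancelable S s \<longleftrightarrow>
     (\<forall>x \<in> carrier S. \<forall>y \<in> carrier S. x \<otimes>\<^bsub>S\<^esub> s = y \<otimes>\<^bsub>S\<^esub> s \<longrightarrow> x = y)"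


lemma ultrafilter_onD:
  assumes "ultrafilter_on X p"
  shows "A \<in> p \<Longrightarrow> A \<subseteq> X" "X \<in> p" "{} \<notin> p"
    "A \<in> p \<Longrightarrow> B \<in> p \<Longrightarrow> A \<inter> B \<in> p"
    "A \<in> p \<Longrightarrow> A \<subseteq> B \<Longrightarrow> B \<subseteq> X \<Longrightarrow> B \<in> p"
    "A \<subseteq> X \<Longrightarrow> A \<in> p \<or> X - A \<in> p"
  using assms unfolding ultrafilter_on_def by auto

lemma ultrafilter_on_Int_iff:
  assumes "ultrafilter_on X p" "A \<subseteq> X" "B \<subseteq> X"
  shows "A \<inter> B \<in> p \<longleftrightarrow> A \<in> p \<and> B \<in> p"
  using ultrafilter_onD(4)[OF assms(1)] ultrafilter_onD(5)[OF assms(1)] assms(2,3)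
  by (meson inf.cobounded1 inf.cobounded2)

lemma ultrafilter_on_Diff_iff:
  assumes "ultrafilter_on X p" "A \<subseteq> X"
  shows "X - A \<in> p \<longleftrightarrow> A \<notin> p"
  using ultrafilter_onD(3,6)[OF assms(1)] ultrafilter_onD(4)[OF assms(1), of A "X - A"] assms(2)
  by auto

lemma ultrafilter_on_principal: "x \<in> X \<Longrightarrow> ultrafilter_on X (principal_uf X x)"
  unfolding ultrafilter_on_def principal_uf_def by auto

lemma beta_closure_Int:
  assumes "A \<subseteq> X" "B \<subseteq> X"
  shows "beta_closure X A \<inter> beta_closure X B = beta_closure X (A \<inter> B)"
  using ultrafilter_on_Int_iff[OF _ assms] unfolding beta_closure_def beta_def by auto

lemma beta_closure_self: "beta_closure X X = beta X"
  unfolding beta_closure_def beta_def using ultrafilter_onD(2) by auto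

lemma topspace_beta_topology [simp]: "topspace (beta_topology X) = beta X"
proof -
  have "beta_closure X A \<subseteq> beta X" for A
    unfolding beta_closure_def by auto
  then show ?thesis
    unfolding beta_topology_def topology_generated_by_topspace
    using beta_closure_self[of X] by blast
qed

lemma openin_beta_topology:
  "openin (beta_topology X) U \<longleftrightarrow>
     U \<subseteq> beta X \<and> (\<forall>p\<in>U. \<exists>A. A \<subseteq> X \<and> p \<in> beta_closure X A \<and> beta_closure X A \<subseteq> U)"
    (is "_ \<longleftrightarrow> ?R U")
proof
  assume "openin (beta_topology X) U"
  then have "generate_topology_on {beta_closure X A | A. A \<subseteq> X} U"
    unfolding beta_topology_def by (rule openin_topology_generated_by)
  then show "?R U"
  proof induction
    case Empty
    then show ?case by simp
  next
    case (Int U V)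
    have "\<exists>A. A \<subseteq> X \<and> p \<in> beta_closure X A \<and> beta_closure X A \<subseteq> U \<inter> V" if p: "p \<in> U \<inter> V" for p
    proof -
      obtain A B where "A \<subseteq> X" "p \<in> beta_closure X A" "beta_closure X A \<subseteq> U"
        "B \<subseteq> X" "p \<in> beta_closure X B" "beta_closure X B \<subseteq> V"
        using Int.IH p by (meson IntD1 IntD2)
      then show ?thesis
        using beta_closure_Int[of A X B] by (intro exI[of _ "A \<inter> B"]) auto
    qed
    then show ?case using Int.IH by blast
  next
    case (UN K)
    then show ?case by (meson Sup_le_iff Union_iff Union_upper subset_trans)
  next
    case (Basis S)
    then show ?case unfolding beta_closure_def by auto
  qed
next
  assume R: "?R U"
  define F where "F = {beta_closure X A | A. A \<subseteq> X \<and> beta_closure X A \<subseteq> U}"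
  have "U = \<Union>F" using R unfolding F_def by blast
  moreover have "openin (beta_topology X) (\<Union>F)"
    by (rule openin_Union) (auto simp: F_def beta_topology_def intro: topology_generated_by_Basis)
  ultimately show "openin (beta_topology X) U" by simp
qed

context group
begin

lemma mem_inv_l_coset:
  assumes "g \<in> carrier G" "A \<subseteq> carrier G" "x \<in> carrier G"
  shows "x \<in> inv g <# A \<longleftrightarrow> g \<otimes> x \<in> A"
proof
  assume "x \<in> inv g <# A"
  then obtain a where "a \<in> A" "x = inv g \<otimes> a"
    unfolding l_coset_def by auto
  then show "g \<otimes> x \<in> A"
    using assms by (metis inv_closed inv_inv inv_solve_left subsetD)
next
  assume "g \<otimes> x \<in> A"
  moreover have "x = inv g \<otimes> (g \<otimes> x)"
    using assms by (simp add: m_assoc[symmetric])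
  ultimately show "x \<in> inv g <# A"
    unfolding l_coset_def by auto
qed

lemma inv_l_coset_eq:
  assumes "g \<in> carrier G" "A \<subseteq> carrier G"
  shows "inv g <# A = {x \<in> carrier G. g \<otimes> x \<in> A}"
  using mem_inv_l_coset[OF assms] l_coset_subset_G[OF assms(2), of "inv g"] assms(1) by auto

lemma uf_mult_iff:
  "A \<in> uf_mult G p q \<longleftrightarrow>
     A \<subseteq> carrier G \<and> {g \<in> carrier G. {x \<in> carrier G. g \<otimes> x \<in> A} \<in> q} \<in> p"
  unfolding uf_mult_def using inv_l_coset_eq by (auto cong: conj_cong)

lemma uf_mult_principal:
  assumes "g \<in> carrier G" "ultrafilter_on (carrier G) p"
  shows "uf_mult G (principal_uf (carrier G) g) p = {g <# B | B. B \<in> p}"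
proof -
  have "A \<in> uf_mult G (principal_uf (carrier G) g) p \<longleftrightarrow> A \<subseteq> carrier G \<and> inv g <# A \<in> p" for A
    using assms(1) unfolding uf_mult_def principal_uf_def by auto
  moreover have "A \<subseteq> carrier G \<and> inv g <# A \<in> p \<longleftrightarrow> (\<exists>B. A = g <# B \<and> B \<in> p)" for A
  proof
    assume A: "A \<subseteq> carrier G \<and> inv g <# A \<in> p"
    then have "A = g <# (inv g <# A)"
      using assms(1) by (simp add: lcos_m_assoc lcos_mult_one)
    then show "\<exists>B. A = g <# B \<and> B \<in> p" using A by blast
  next
    assume "\<exists>B. A = g <# B \<and> B \<in> p"
    then obtain B where B: "A = g <# B" "B \<in> p" by blast
    have "B \<subseteq> carrier G" using ultrafilter_onD(1)[OF assms(2) B(2)] .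
    then show "A \<subseteq> carrier G \<and> inv g <# A \<in> p"
      using assms(1) B by (simp add: lcos_m_assoc lcos_mult_one l_coset_subset_G)
  qed
  ultimately show ?thesis by auto
qed

lemma ultrafilter_on_uf_mult:
  assumes p: "ultrafilter_on (carrier G) p" and q: "ultrafilter_on (carrier G) q"
  shows "ultrafilter_on (carrier G) (uf_mult G p q)"
proof -
  define T where "T A g = {x \<in> carrier G. g \<otimes> x \<in> A}" for A g
  define S where "S A = {g \<in> carrier G. T A g \<in> q}" for A
  have mem: "A \<in> uf_mult G p q \<longleftrightarrow> A \<subseteq> carrier G \<and> S A \<in> p" for A
    unfolding uf_mult_iff S_def T_def ..
  have T: "T A g \<subseteq> carrier G" for A g by (auto simp: T_def)
  have S: "S A \<subseteq> carrier G" for A by (auto simp: S_def)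
  have "T (A \<inter> B) g = T A g \<inter> T B g" for A B g by (auto simp: T_def)
  then have S_Int: "S (A \<inter> B) = S A \<inter> S B" for A B
    using ultrafilter_on_Int_iff[OF q T T] by (auto simp: S_def)
  have "T (carrier G - A) g = carrier G - T A g" if "g \<in> carrier G" for A g
    using that by (auto simp: T_def)
  then have S_Diff: "S (carrier G - A) = carrier G - S A" for A
    using ultrafilter_on_Diff_iff[OF q T] by (auto simp: S_def)
  have "T (carrier G) g = carrier G" if "g \<in> carrier G" for g
    using that by (auto simp: T_def)
  then have S_carrier: "S (carrier G) = carrier G"
    using ultrafilter_onD(2)[OF q] by (auto simp: S_def)
  have S_empty: "S {} = {}"
    using ultrafilter_onD(3)[OF q] by (auto simp: S_def T_def)
  have S_mono: "S A \<subseteq> S B" if "A \<subseteq> B" for A B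
    using S_Int[of A B] that by (simp add: inf.absorb1 inf.absorb_iff1)
  show ?thesis
    unfolding ultrafilter_on_def
  proof (intro conjI ballI allI impI)
    show "uf_mult G p q \<subseteq> Pow (carrier G)" using mem by auto
    show "carrier G \<in> uf_mult G p q" using mem S_carrier ultrafilter_onD(2)[OF p] by simp
    show "{} \<notin> uf_mult G p q" using mem S_empty ultrafilter_onD(3)[OF p] by simp
  next
    fix A B assume "A \<in> uf_mult G p q" "B \<in> uf_mult G p q"
    then show "A \<inter> B \<in> uf_mult G p q"
      using ultrafilter_onD(4)[OF p] by (auto simp: mem S_Int)
  next
    fix A B assume "A \<in> uf_mult G p q" "A \<subseteq> B \<and> B \<subseteq> carrier G"
    then show "B \<in> uf_mult G p q"
      using ultrafilter_onD(5)[OF p _ S_mono S] by (auto simp: mem)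
  next
    fix A assume "A \<subseteq> carrier G"
    then show "A \<in> uf_mult G p q \<or> carrier G - A \<in> uf_mult G p q"
      using ultrafilter_onD(6)[OF p S] by (auto simp: mem S_Diff)
  qed
qed

lemma monoid_beta_monoid: "monoid (beta_monoid G)"
proof (rule monoidI; simp add: beta_monoid_def beta_def)
  show "ultrafilter_on (carrier G) (uf_mult G p q)"
    if "ultrafilter_on (carrier G) p" "ultrafilter_on (carrier G) q" for p q
    using that by (rule ultrafilter_on_uf_mult)
  show "ultrafilter_on (carrier G) (principal_uf (carrier G) \<one>)"
    by (simp add: ultrafilter_on_principal)
  have eq: "{x \<in> carrier G. x \<in> A} = A" if "A \<subseteq> carrier G" for A
    using that by auto
  show "uf_mult G (principal_uf (carrier G) \<one>) p = p"
    if "ultrafilter_on (carrier G) p" for p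
    using ultrafilter_onD(1)[OF that]
    by (auto simp: uf_mult_iff principal_uf_def eq cong: conj_cong)
  show "uf_mult G p (principal_uf (carrier G) \<one>) = p"
    if "ultrafilter_on (carrier G) p" for p
    using ultrafilter_onD(1)[OF that]
    by (auto simp: uf_mult_iff principal_uf_def eq cong: conj_cong)
  show "uf_mult G (uf_mult G p q) r = uf_mult G p (uf_mult G q r)"
    if "ultrafilter_on (carrier G) p" "ultrafilter_on (carrier G) q"
      "ultrafilter_on (carrier G) r" for p q r
  proof (rule Set.set_eqI)
    fix A
    have 1: "{x \<in> carrier G. g \<otimes> h \<otimes> x \<in> A} = {x \<in> carrier G. h \<otimes> x \<in> {y \<in> carrier G. g \<otimes> y \<in> A}}"
      if "g \<in> carrier G" "h \<in> carrier G" for g h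
      using that by (auto simp: m_assoc)
    have "{h \<in> carrier G. g \<otimes> h \<in> {k \<in> carrier G. {x \<in> carrier G. k \<otimes> x \<in> A} \<in> r}} =
        {h \<in> carrier G. {x \<in> carrier G. h \<otimes> x \<in> {y \<in> carrier G. g \<otimes> y \<in> A}} \<in> r}"
      if "g \<in> carrier G" for g
      using that by (auto simp: 1)
    then have "{g \<in> carrier G. {h \<in> carrier G. g \<otimes> h \<in> {k \<in> carrier G. {x \<in> carrier G. k \<otimes> x \<in> A} \<in> r}} \<in> q} =
        {g \<in> carrier G. {x \<in> carrier G. g \<otimes> x \<in> A} \<in> uf_mult G q r}"
      by (auto simp: uf_mult_iff[of _ q r])
    moreover have "A \<in> uf_mult G (uf_mult G p q) r \<longleftrightarrow> A \<subseteq> carrier G \<and>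
        {g \<in> carrier G. {h \<in> carrier G. g \<otimes> h \<in> {k \<in> carrier G. {x \<in> carrier G. k \<otimes> x \<in> A} \<in> r}} \<in> q} \<in> p"
      unfolding uf_mult_iff[of A] uf_mult_iff[of _ p q] by blast
    ultimately show "A \<in> uf_mult G (uf_mult G p q) r \<longleftrightarrow> A \<in> uf_mult G p (uf_mult G q r)"
      unfolding uf_mult_iff[of A p] by simp
  qed
qed

end

end

theory Submission
  imports Defs
begin

text \<open>For an ultrafilter \<open>q\<close> on \<open>G\<close> and \<open>B \<subseteq> G\<close>, let \<open>hits q B = {g \<in> G. B \<in> gq}\<close>. Both sides of
  the equivalence say, for each \<open>q \<in> A\<^sup>*\<close>, that some \<open>B \<in> q\<close> has \<open>hits q B = {\<one>}\<close>, that is, that a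
  neighbourhood of \<open>q\<close> contains no translate \<open>gq\<close> with \<open>g \<noteq> \<one>\<close>.

  On the side of topology (\<open>disparse_iff_hits\<close>), discreteness of \<open>\<Delta>\<^sub>q(A)\<close> only isolates \<open>q\<close> among the
  \<^emph>\<open>points\<close> \<open>gq\<close>; since \<open>G\<close> acts freely on \<open>\<beta>G\<close> (\<open>point_mult_free\<close>), distinct \<open>g\<close> give distinct
  points. Conversely, \<open>q \<in> Gp\<close> implies \<open>Gp = Gq\<close>, so isolating each \<open>q \<in> A\<^sup>*\<close> in its own orbit is
  enough to make every companion discrete.

  On the side of algebra (\<open>right_cancelable_iff_hits\<close>), if every \<open>hits q B\<close> contains some
  \<open>g \<noteq> \<one>\<close>, then the sets \<open>hits q B - {\<one>}\<close> generate a filter, and an ultrafilter \<open>r\<close> above it is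
  different from \<open>\<one>\<close> but satisfies \<open>rq = q = \<one>q\<close>. If \<open>hits q B = {\<one>}\<close>, then \<open>Gq\<close> is a countable
  discrete set, and its points have pairwise disjoint neighbourhoods; thus a set that
  separates \<open>x\<close> from \<open>y\<close> yields a set that separates \<open>xq\<close> from \<open>yq\<close>.\<close>

section \<open>Ultrafilters\<close>

text \<open>The ultrafilter lemma. A maximal intersection-closed family of nonempty sets contains every
  set that meets all its members, because the supersets of the traces on such a set form a family
  of the same kind; all the ultrafilter axioms follow from this.\<close>

lemma ultrafilter_on_extends:
  assumes ne: "\<B> \<noteq> {}" and sub: "\<B> \<subseteq> Pow X" and proper: "{} \<notin> \<B>"
    and Int: "\<And>B C. B \<in> \<B> \<Longrightarrow> C \<in> \<B> \<Longrightarrow> B \<inter> C \<in> \<B>"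
  obtains p where "ultrafilter_on X p" "\<B> \<subseteq> p"
proof -
  define \<Phi> where "\<Phi> = {F. \<B> \<subseteq> F \<and> F \<subseteq> Pow X \<and> {} \<notin> F \<and> (\<forall>B\<in>F. \<forall>C\<in>F. B \<inter> C \<in> F)}"
  have \<Phi>D: "\<B> \<subseteq> F" "F \<subseteq> Pow X" "{} \<notin> F" "\<And>B C. B \<in> F \<Longrightarrow> C \<in> F \<Longrightarrow> B \<inter> C \<in> F"
    if "F \<in> \<Phi>" for F
    using that by (simp_all add: \<Phi>_def)
  have \<Phi>I: "F \<in> \<Phi>" if "\<B> \<subseteq> F" "F \<subseteq> Pow X" "{} \<notin> F" "\<And>B C. B \<in> F \<Longrightarrow> C \<in> F \<Longrightarrow> B \<inter> C \<in> F" for F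
    using that by (simp add: \<Phi>_def)
  have "\<exists>p\<in>\<Phi>. \<forall>F\<in>\<Phi>. p \<subseteq> F \<longrightarrow> F = p"
  proof (rule subset_Zorn_nonempty)
    have "\<B> \<in> \<Phi>" using sub proper Int by (intro \<Phi>I) auto
    then show "\<Phi> \<noteq> {}" by blast
  next
    fix \<C> assume \<C>: "\<C> \<noteq> {}" "subset.chain \<Phi> \<C>"
    then have mem: "\<C> \<subseteq> \<Phi>" and chain: "\<And>F F'. F \<in> \<C> \<Longrightarrow> F' \<in> \<C> \<Longrightarrow> F \<subseteq> F' \<or> F' \<subseteq> F"
      by (auto simp: subset_chain_def)
    show "\<Union>\<C> \<in> \<Phi>"
    proof (rule \<Phi>I)
      show "\<B> \<subseteq> \<Union>\<C>" using \<C>(1) mem \<Phi>D(1) by fast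
      show "\<Union>\<C> \<subseteq> Pow X" using mem \<Phi>D(2) by (meson Sup_least subsetD)
      show "{} \<notin> \<Union>\<C>" using mem \<Phi>D(3) by (meson UnionE subsetD)
    next
      fix B C assume "B \<in> \<Union>\<C>" "C \<in> \<Union>\<C>"
      then obtain F F' where "B \<in> F" "F \<in> \<C>" "C \<in> F'" "F' \<in> \<C>" by (elim UnionE)
      then obtain F'' where F'': "F'' \<in> \<C>" "B \<in> F''" "C \<in> F''" using chain by (meson subsetD)
      then have "B \<inter> C \<in> F''" using mem \<Phi>D(4) by (meson subsetD)
      then show "B \<inter> C \<in> \<Union>\<C>" using F''(1) by (rule UnionI[rotated])
    qed
  qed
  then obtain p where p: "p \<in> \<Phi>" and max: "\<And>F. F \<in> \<Phi> \<Longrightarrow> p \<subseteq> F \<Longrightarrow> F = p" by blast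
  have p_sub: "p \<subseteq> Pow X" and p_proper: "{} \<notin> p" and \<B>p: "\<B> \<subseteq> p"
    and p_Int: "\<And>B C. B \<in> p \<Longrightarrow> C \<in> p \<Longrightarrow> B \<inter> C \<in> p"
    using \<Phi>D[OF p] by auto
  have meets: "A \<in> p" if A: "A \<subseteq> X" "\<And>B. B \<in> p \<Longrightarrow> A \<inter> B \<noteq> {}" for A
  proof -
    define F where "F = {C. C \<subseteq> X \<and> (\<exists>B\<in>p. A \<inter> B \<subseteq> C)}"
    have pF: "p \<subseteq> F" using p_sub unfolding F_def by blast
    have "F \<in> \<Phi>"
    proof (rule \<Phi>I)
      show "\<B> \<subseteq> F" using \<B>p pF by (rule order_trans)
      show "F \<subseteq> Pow X" unfolding F_def by blast
      show "{} \<notin> F" using A(2) unfolding F_def by blast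
    next
      fix C D assume "C \<in> F" "D \<in> F"
      then obtain B B' where "B \<in> p" "A \<inter> B \<subseteq> C" "B' \<in> p" "A \<inter> B' \<subseteq> D" "C \<subseteq> X"
        unfolding F_def by blast
      then show "C \<inter> D \<in> F"
        using p_Int[of B B'] unfolding F_def by (intro CollectI conjI bexI[of _ "B \<inter> B'"]) auto
    qed
    then have "F = p" using max pF by blast
    moreover have "A \<in> F" using A(1) ne \<B>p unfolding F_def by blast
    ultimately show ?thesis by blast
  qed
  have "ultrafilter_on X p"
    unfolding ultrafilter_on_def
  proof (intro conjI ballI allI impI)
    show "p \<subseteq> Pow X" "{} \<notin> p" by (fact p_sub p_proper)+
    show "X \<in> p" using p_sub p_proper by (intro meets) (auto simp: Int_absorb1)
    show "A \<inter> B \<in> p" if "A \<in> p" "B \<in> p" for A B using p_Int that .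
    show "B \<in> p" if "A \<in> p" "A \<subseteq> B \<and> B \<subseteq> X" for A B
    proof (rule meets)
      fix C assume "C \<in> p"
      then have "A \<inter> C \<noteq> {}" using p_Int[OF that(1)] p_proper by force
      then show "B \<inter> C \<noteq> {}" using that(2) by blast
    qed (use that in blast)
    show "A \<in> p \<or> X - A \<in> p" if A: "A \<subseteq> X" for A
    proof (rule disjCI)
      assume "X - A \<notin> p"
      then obtain B where B: "B \<in> p" "(X - A) \<inter> B = {}" using meets[of "X - A"] by blast
      show "A \<in> p"
      proof (rule meets[OF A])
        fix C assume "C \<in> p"
        then have "B \<inter> C \<noteq> {}" using p_Int[OF B(1)] p_proper by force
        moreover have "B \<subseteq> A" using B p_sub by blast
        ultimately show "A \<inter> C \<noteq> {}" by blast
      qed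
    qed
  qed
  then show thesis using \<B>p that by blast
qed

lemma ultrafilter_on_eqI:
  assumes p: "ultrafilter_on X p" and q: "ultrafilter_on X q" and "p \<subseteq> q"
  shows "p = q"
proof
  show "q \<subseteq> p"
  proof
    fix A assume A: "A \<in> q"
    then have "A \<subseteq> X" "X - A \<notin> q"
      using ultrafilter_onD(1)[OF q] ultrafilter_on_Diff_iff[OF q] by auto
    then show "A \<in> p" using ultrafilter_onD(6)[OF p] \<open>p \<subseteq> q\<close> by blast
  qed
qed fact

section \<open>The action of a group on its ultrafilters\<close>

context group
begin

abbreviation point_mult :: "'a \<Rightarrow> 'a set set \<Rightarrow> 'a set set" where
  "point_mult g q \<equiv> uf_mult G (principal_uf (carrier G) g) q"

definition hits :: "'a set set \<Rightarrow> 'a set \<Rightarrow> 'a set" where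
  "hits q B = {g \<in> carrier G. {x \<in> carrier G. g \<otimes> x \<in> B} \<in> q}"

lemma mem_uf_mult_iff_hits: "B \<in> uf_mult G p q \<longleftrightarrow> B \<subseteq> carrier G \<and> hits q B \<in> p"
  unfolding uf_mult_iff hits_def ..

lemma mem_point_mult_iff:
  assumes "g \<in> carrier G"
  shows "B \<in> point_mult g q \<longleftrightarrow> B \<subseteq> carrier G \<and> {x \<in> carrier G. g \<otimes> x \<in> B} \<in> q"
  using assms unfolding uf_mult_iff principal_uf_def by auto

lemma mem_hits_iff: "B \<subseteq> carrier G \<Longrightarrow> g \<in> hits q B \<longleftrightarrow> g \<in> carrier G \<and> B \<in> point_mult g q"
  unfolding hits_def using mem_point_mult_iff by auto

lemma ultrafilter_on_point_mult:
  "g \<in> carrier G \<Longrightarrow> ultrafilter_on (carrier G) q \<Longrightarrow> ultrafilter_on (carrier G) (point_mult g q)"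
  by (intro ultrafilter_on_uf_mult ultrafilter_on_principal)

lemma point_mult_point_mult:
  assumes "g \<in> carrier G" "h \<in> carrier G"
  shows "point_mult g (point_mult h q) = point_mult (g \<otimes> h) q"
proof -
  have "{x \<in> carrier G. h \<otimes> x \<in> {y \<in> carrier G. g \<otimes> y \<in> B}} = {x \<in> carrier G. g \<otimes> h \<otimes> x \<in> B}" for B
    using assms by (auto simp: m_assoc)
  then show ?thesis
    using assms by (intro Set.set_eqI) (simp add: mem_point_mult_iff)
qed

lemma point_mult_one:
  assumes "ultrafilter_on (carrier G) q"
  shows "point_mult \<one> q = q"
proof -
  have "{x \<in> carrier G. x \<in> B} = B" if "B \<subseteq> carrier G" for B using that by blast
  then show ?thesis
    using ultrafilter_onD(1)[OF assms]
    by (intro Set.set_eqI) (auto simp: mem_point_mult_iff cong: conj_cong)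
qed

lemma point_mult_principal:
  assumes "g \<in> carrier G" "x \<in> carrier G"
  shows "point_mult g (principal_uf (carrier G) x) = principal_uf (carrier G) (g \<otimes> x)"
proof -
  have "{y \<in> carrier G. g \<otimes> y \<in> B} \<in> principal_uf (carrier G) x \<longleftrightarrow> g \<otimes> x \<in> B" for B
    using assms by (auto simp: principal_uf_def)
  then show ?thesis
    using assms by (intro Set.set_eqI) (simp add: mem_point_mult_iff, simp add: principal_uf_def)
qed

lemma point_mult_inv:
  assumes "g \<in> carrier G" "ultrafilter_on (carrier G) q"
  shows "point_mult (inv g) (point_mult g q) = q"
  using assms by (simp add: point_mult_point_mult point_mult_one)

lemma point_mult_in_remainder:
  assumes g: "g \<in> carrier G" and q: "q \<in> beta_remainder (carrier G)"
  shows "point_mult g q \<in> beta_remainder (carrier G)"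
proof -
  have uq: "ultrafilter_on (carrier G) q" using q by (simp add: beta_remainder_def beta_def)
  have "point_mult g q \<noteq> principal_uf (carrier G) x" if x: "x \<in> carrier G" for x
  proof
    assume "point_mult g q = principal_uf (carrier G) x"
    then have "q = principal_uf (carrier G) (inv g \<otimes> x)"
      using point_mult_inv[OF g uq] g x by (simp add: point_mult_principal)
    then show False using q g x by (auto simp: beta_remainder_def)
  qed
  then show ?thesis
    using ultrafilter_on_point_mult[OF g uq] by (auto simp: beta_remainder_def beta_def)
qed

text \<open>For \<open>g \<noteq> \<one>\<close>, left translation by \<open>g\<close> has no fixed point on \<open>G\<close>, so no point can lie outside
  \<open>M \<union> gM \<union> g\<^sup>-\<^sup>1M\<close> when \<open>M\<close> is maximal among the sets disjoint from their preimage \<open>g\<^sup>-\<^sup>1M\<close>. An ultrafilter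
  fixed by \<open>g\<close> contains one of these three sets, hence both of the disjoint sets \<open>M\<close> and
  \<open>g\<^sup>-\<^sup>1M\<close>.\<close>

lemma point_mult_free:
  assumes g: "g \<in> carrier G" and q: "ultrafilter_on (carrier G) q" and fixed: "point_mult g q = q"
  shows "g = \<one>"
proof (rule ccontr)
  assume "g \<noteq> \<one>"
  then have no_fix: "g \<otimes> x \<noteq> x" if "x \<in> carrier G" for x using that g by (metis r_cancel_one)
  define pre where "pre B = {x \<in> carrier G. g \<otimes> x \<in> B}" for B
  have pre_iff: "pre B \<in> q \<longleftrightarrow> B \<in> q" if "B \<subseteq> carrier G" for B
    using that mem_point_mult_iff[OF g, of B q] by (simp add: fixed pre_def)
  define \<Phi> where "\<Phi> = {M. M \<subseteq> carrier G \<and> (\<forall>x\<in>M. g \<otimes> x \<notin> M)}"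
  have "\<exists>M\<in>\<Phi>. \<forall>N\<in>\<Phi>. M \<subseteq> N \<longrightarrow> N = M"
  proof (rule subset_Zorn')
    fix \<C> assume "subset.chain \<Phi> \<C>"
    then have mem: "\<C> \<subseteq> \<Phi>" and chain: "\<And>F F'. F \<in> \<C> \<Longrightarrow> F' \<in> \<C> \<Longrightarrow> F \<subseteq> F' \<or> F' \<subseteq> F"
      by (auto simp: subset_chain_def)
    have "g \<otimes> x \<notin> N" if "x \<in> M" "M \<in> \<C>" "N \<in> \<C>" for x M N
      using chain[OF that(2,3)] that mem unfolding \<Phi>_def by blast
    then show "\<Union>\<C> \<in> \<Phi>" using mem unfolding \<Phi>_def by blast
  qed
  then obtain M where M: "M \<in> \<Phi>" and max: "\<And>N. N \<in> \<Phi> \<Longrightarrow> M \<subseteq> N \<Longrightarrow> N = M" by blast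
  have sub: "M \<subseteq> carrier G" and avoid: "\<And>x. x \<in> M \<Longrightarrow> g \<otimes> x \<notin> M" using M unfolding \<Phi>_def by auto
  have cover: "x \<in> M \<or> g \<otimes> x \<in> M \<or> x \<in> (\<lambda>y. g \<otimes> y) ` M" if x: "x \<in> carrier G" for x
  proof (rule ccontr)
    assume out: "\<not> ?thesis"
    then have "insert x M \<in> \<Phi>" using sub avoid x no_fix[OF x] unfolding \<Phi>_def by auto
    then show False using max out by blast
  qed
  define N where "N = (\<lambda>y. g \<otimes> y) ` M"
  have N: "N \<subseteq> carrier G" using sub g unfolding N_def by auto
  have "g \<otimes> x = g \<otimes> y \<longleftrightarrow> x = y" if "x \<in> carrier G" "y \<in> carrier G" for x y
    using that g by simp
  then have pre_N: "pre N = M" using sub unfolding pre_def N_def by blast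
  have "M \<in> q"
  proof (rule ccontr)
    assume "M \<notin> q"
    then have "carrier G - M \<in> q" "carrier G - pre M \<in> q" "carrier G - N \<in> q"
      using pre_iff[OF sub] pre_iff[OF N] pre_N sub N
      by (auto simp: ultrafilter_on_Diff_iff[OF q] pre_def)
    then have "(carrier G - M) \<inter> (carrier G - pre M) \<inter> (carrier G - N) \<in> q"
      by (intro ultrafilter_onD(4)[OF q])
    moreover have "(carrier G - M) \<inter> (carrier G - pre M) \<inter> (carrier G - N) = {}"
      using cover unfolding pre_def N_def by blast
    ultimately show False using ultrafilter_onD(3)[OF q] by simp
  qed
  then have "M \<inter> pre M \<in> q" using pre_iff[OF sub] ultrafilter_onD(4)[OF q] by blast
  moreover have "M \<inter> pre M = {}" using avoid unfolding pre_def by blast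
  ultimately show False using ultrafilter_onD(3)[OF q] by simp
qed

lemma one_in_hits:
  assumes "ultrafilter_on (carrier G) q" "B \<in> q"
  shows "\<one> \<in> hits q B"
  using assms ultrafilter_onD(1)[OF assms] by (simp add: mem_hits_iff point_mult_one)

lemma hits_Int:
  assumes q: "ultrafilter_on (carrier G) q" and "B \<subseteq> carrier G" "C \<subseteq> carrier G"
  shows "hits q (B \<inter> C) = hits q B \<inter> hits q C"
proof -
  have "B \<inter> C \<subseteq> carrier G" using assms by blast
  then show ?thesis
    using assms ultrafilter_on_Int_iff[OF ultrafilter_on_point_mult[OF _ q]]
    by (auto simp: mem_hits_iff)
qed

section \<open>Right cancelability\<close>

text \<open>An ultrafilter containing all \<open>hits q B - {\<one>}\<close> is a second left identity of \<open>q\<close>.\<close>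

lemma right_cancelable_imp_hits:
  assumes q: "ultrafilter_on (carrier G) q" and canc: "right_cancelable (beta_monoid G) q"
  shows "\<exists>B\<in>q. hits q B = {\<one>}"
proof (rule ccontr)
  assume contra: "\<not> ?thesis"
  let ?H = "(\<lambda>B. hits q B - {\<one>}) ` q"
  have Int: "S \<inter> T \<in> ?H" if ST: "S \<in> ?H" "T \<in> ?H" for S T
  proof -
    obtain B C where BC: "B \<in> q" "C \<in> q" "S = hits q B - {\<one>}" "T = hits q C - {\<one>}"
      using ST by blast
    then have "S \<inter> T = hits q (B \<inter> C) - {\<one>}"
      using hits_Int[OF q] ultrafilter_onD(1)[OF q] by auto
    then show ?thesis using ultrafilter_onD(4)[OF q BC(1,2)] by blast
  qed
  have proper: "{} \<notin> ?H" using contra one_in_hits[OF q] by blast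
  have sub: "?H \<subseteq> Pow (carrier G)" unfolding hits_def by auto
  have ne: "?H \<noteq> {}" using ultrafilter_onD(2)[OF q] by blast
  obtain r where r: "ultrafilter_on (carrier G) r" "?H \<subseteq> r"
    using ultrafilter_on_extends[OF ne sub proper Int] .
  have hits_r: "hits q B \<in> r" if "B \<in> q" for B
  proof (rule ultrafilter_onD(5)[OF r(1)])
    show "hits q B - {\<one>} \<in> r" using r(2) that by blast
  qed (auto simp: hits_def)
  have "q \<subseteq> uf_mult G r q"
    using hits_r ultrafilter_onD(1)[OF q] by (auto simp: mem_uf_mult_iff_hits)
  then have "q = uf_mult G r q"
    by (intro ultrafilter_on_eqI[OF q] ultrafilter_on_uf_mult r q)
  then have "uf_mult G r q = uf_mult G (principal_uf (carrier G) \<one>) q"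
    using point_mult_one[OF q] by simp
  then have r_one: "r = principal_uf (carrier G) \<one>"
    using canc r(1) ultrafilter_on_principal[OF one_closed]
    unfolding right_cancelable_def by (auto simp: beta_monoid_def beta_def)
  have "hits q (carrier G) - {\<one>} \<in> r" using r(2) ultrafilter_onD(2)[OF q] by blast
  then show False unfolding r_one principal_uf_def by blast
qed

text \<open>Countability makes it possible to disjointify the translates \<open>gB\<close> along an enumeration of
  \<open>G\<close>. What is removed from \<open>gB\<close> is a finite union of sets \<open>hB\<close> with \<open>h \<noteq> g\<close>, none of which belongs to
  \<open>gq\<close>, so what is left of \<open>gB\<close> still belongs to \<open>gq\<close>.\<close>

lemma disjoint_neighbourhoods_of_orbit:
  assumes cnt: "countable (carrier G)" and q: "ultrafilter_on (carrier G) q"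
    and B: "B \<in> q" "hits q B = {\<one>}"
  obtains D where "\<forall>g\<in>carrier G. D g \<in> point_mult g q" "disjoint_family_on D (carrier G)"
proof -
  let ?e = "to_nat_on (carrier G)"
  define E where "E g = {y \<in> carrier G. inv g \<otimes> y \<in> B}" for g
  have Esub: "E g \<subseteq> carrier G" for g unfolding E_def by blast
  have E_iff: "E h \<in> point_mult g q \<longleftrightarrow> g = h" if gh: "g \<in> carrier G" "h \<in> carrier G" for g h
  proof -
    have "{x \<in> carrier G. g \<otimes> x \<in> E h} = {x \<in> carrier G. (inv h \<otimes> g) \<otimes> x \<in> B}"
      using gh unfolding E_def by (auto simp: m_assoc)
    then have "E h \<in> point_mult g q \<longleftrightarrow> inv h \<otimes> g \<in> hits q B"
      using gh Esub by (simp add: mem_point_mult_iff hits_def)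
    also have "\<dots> \<longleftrightarrow> g = h"
      using inv_solve_left'[OF one_closed, of h g] gh B(2) by auto
    finally show ?thesis .
  qed
  define prev where "prev g = {h \<in> carrier G. ?e h < ?e g}" for g
  have fin: "finite (prev g)" for g
  proof (rule finite_imageD)
    show "finite (?e ` prev g)" by (rule finite_subset[of _ "{..< ?e g}"]) (auto simp: prev_def)
    show "inj_on ?e (prev g)"
      by (rule inj_on_subset[OF inj_on_to_nat_on[OF cnt]]) (auto simp: prev_def)
  qed
  define D where "D g = E g - (\<Union>h\<in>prev g. E h)" for g
  have "D g \<in> point_mult g q" if g: "g \<in> carrier G" for g
  proof -
    note u = ultrafilter_on_point_mult[OF g q]
    have "E g - (\<Union>h\<in>F. E h) \<in> point_mult g q" if "finite F" "F \<subseteq> carrier G - {g}" for F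
      using that
    proof (induction rule: finite_induct)
      case empty
      then show ?case using E_iff[OF g g] by simp
    next
      case (insert h F)
      then have "carrier G - E h \<in> point_mult g q"
        using ultrafilter_on_Diff_iff[OF u Esub] E_iff[OF g, of h] by auto
      then have "(E g - (\<Union>h\<in>F. E h)) \<inter> (carrier G - E h) \<in> point_mult g q"
        using insert ultrafilter_onD(4)[OF u] by blast
      moreover have "(E g - (\<Union>h\<in>F. E h)) \<inter> (carrier G - E h) = E g - (\<Union>h\<in>insert h F. E h)"
        using Esub by blast
      ultimately show ?case by simp
    qed
    then show ?thesis unfolding D_def using fin by (auto simp: prev_def)
  qed
  moreover have "D g \<inter> D h = {}" if gh: "g \<in> carrier G" "h \<in> carrier G" "g \<noteq> h" for g h
  proof -
    have "?e g \<noteq> ?e h" using gh cnt by simp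
    then have "g \<in> prev h \<or> h \<in> prev g" using gh unfolding prev_def by auto
    then show ?thesis unfolding D_def by blast
  qed
  ultimately show thesis using that[of D] by (simp add: disjoint_family_on_def)
qed

lemma hits_imp_right_cancelable:
  assumes cnt: "countable (carrier G)" and q: "ultrafilter_on (carrier G) q"
    and B: "B \<in> q" "hits q B = {\<one>}"
  shows "right_cancelable (beta_monoid G) q"
proof -
  obtain D where D_all: "\<forall>g\<in>carrier G. D g \<in> point_mult g q"
    and disj: "disjoint_family_on D (carrier G)"
    using disjoint_neighbourhoods_of_orbit[OF assms] .
  have D: "D g \<in> point_mult g q" if "g \<in> carrier G" for g using D_all that by blast
  have Dsub: "D g \<subseteq> carrier G" if "g \<in> carrier G" for g
    using D[OF that] unfolding mem_point_mult_iff[OF that] by blast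
  have union: "(\<Union>g\<in>S. D g) \<in> uf_mult G x q"
    if x: "ultrafilter_on (carrier G) x" and S: "S \<in> x" for x S
  proof -
    have Ssub: "S \<subseteq> carrier G" using ultrafilter_onD(1)[OF x S] .
    have sub: "(\<Union>g\<in>S. D g) \<subseteq> carrier G" using Ssub Dsub by blast
    have "S \<subseteq> hits q (\<Union>g\<in>S. D g)"
    proof
      fix g assume g: "g \<in> S"
      then have gG: "g \<in> carrier G" using Ssub by blast
      have "(\<Union>g\<in>S. D g) \<in> point_mult g q"
        by (rule ultrafilter_onD(5)[OF ultrafilter_on_point_mult[OF gG q] D[OF gG] _ sub])
          (use g in blast)
      then show "g \<in> hits q (\<Union>g\<in>S. D g)" using gG by (simp add: mem_hits_iff[OF sub])
    qed
    then have "hits q (\<Union>g\<in>S. D g) \<in> x"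
      by (rule ultrafilter_onD(5)[OF x S]) (simp add: hits_def)
    then show ?thesis using sub by (simp add: mem_uf_mult_iff_hits)
  qed
  have "x \<subseteq> y" if x: "ultrafilter_on (carrier G) x" and y: "ultrafilter_on (carrier G) y"
    and eq: "uf_mult G x q = uf_mult G y q" for x y
  proof (rule subsetI, rule ccontr)
    fix S assume S: "S \<in> x" "S \<notin> y"
    have Ssub: "S \<subseteq> carrier G" using ultrafilter_onD(1)[OF x S(1)] .
    then have "carrier G - S \<in> y" using S(2) by (simp add: ultrafilter_on_Diff_iff[OF y])
    then have "(\<Union>g\<in>carrier G - S. D g) \<in> uf_mult G x q" using union[OF y] eq by simp
    then have "(\<Union>g\<in>S. D g) \<inter> (\<Union>g\<in>carrier G - S. D g) \<in> uf_mult G x q"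
      by (rule ultrafilter_onD(4)[OF ultrafilter_on_uf_mult[OF x q] union[OF x S(1)]])
    moreover have "(\<Union>g\<in>S. D g) \<inter> (\<Union>g\<in>carrier G - S. D g) = {}"
    proof -
      have "D g \<inter> D h = {}" if "g \<in> S" "h \<in> carrier G - S" for g h
        using that Ssub by (intro disjoint_family_onD[OF disj]) auto
      then show ?thesis by blast
    qed
    ultimately show False using ultrafilter_onD(3)[OF ultrafilter_on_uf_mult[OF x q]] by simp
  qed
  then show ?thesis
    unfolding right_cancelable_def
    by (simp add: beta_monoid_def beta_def) (metis subset_antisym)
qed

lemma right_cancelable_iff_hits:
  assumes "countable (carrier G)" "ultrafilter_on (carrier G) q"
  shows "right_cancelable (beta_monoid G) q \<longleftrightarrow> (\<exists>B\<in>q. hits q B = {\<one>})"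
  using assms right_cancelable_imp_hits hits_imp_right_cancelable by blast

section \<open>Discreteness of companions\<close>

lemma discrete_in_beta_topology_iff:
  assumes "S \<subseteq> beta X"
  shows "subtopology (beta_topology X) S = discrete_topology S
    \<longleftrightarrow> (\<forall>q\<in>S. \<exists>B\<in>q. beta_closure X B \<inter> S = {q})"
proof -
  have "openin (subtopology (beta_topology X) S) {q} \<longleftrightarrow> (\<exists>B\<in>q. beta_closure X B \<inter> S = {q})"
    if q: "q \<in> S" for q
  proof
    assume "openin (subtopology (beta_topology X) S) {q}"
    then obtain U where U: "openin (beta_topology X) U" "{q} = U \<inter> S"
      unfolding openin_subtopology by blast
    then obtain B where B: "q \<in> beta_closure X B" "beta_closure X B \<subseteq> U"
      unfolding openin_beta_topology by blast
    then have "beta_closure X B \<inter> S = {q}" using U q by blast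
    then show "\<exists>B\<in>q. beta_closure X B \<inter> S = {q}" using B(1) unfolding beta_closure_def by blast
  next
    assume "\<exists>B\<in>q. beta_closure X B \<inter> S = {q}"
    then obtain B where B: "B \<in> q" "beta_closure X B \<inter> S = {q}" by blast
    moreover have "B \<subseteq> X" using B(1) q assms by (auto simp: beta_def dest: ultrafilter_onD(1))
    then have "openin (beta_topology X) (beta_closure X B)"
      unfolding beta_topology_def by (intro topology_generated_by_Basis) blast
    ultimately show "openin (subtopology (beta_topology X) S) {q}"
      unfolding openin_subtopology by blast
  qed
  moreover have "topspace (subtopology (beta_topology X) S) = S" using assms by auto
  ultimately show ?thesis
    using discrete_topology_unique[of S "subtopology (beta_topology X) S"] by auto
qed

lemma companion_subset_beta: "companion G p A \<subseteq> beta (carrier G)"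
  unfolding companion_def beta_star_def beta_closure_def by blast

lemma disparse_iff_hits:
  assumes A: "A \<subseteq> carrier G"
  shows "disparse G A \<longleftrightarrow> (\<forall>q\<in>beta_star (carrier G) A. \<exists>B\<in>q. hits q B = {\<one>})"
proof
  assume disp: "disparse G A"
  show "\<forall>q\<in>beta_star (carrier G) A. \<exists>B\<in>q. hits q B = {\<one>}"
  proof
    fix q assume qA: "q \<in> beta_star (carrier G) A"
    then have q: "ultrafilter_on (carrier G) q" and rem: "q \<in> beta_remainder (carrier G)"
      and Aq: "A \<in> q"
      by (auto simp: beta_star_def beta_closure_def beta_def)
    have "q \<in> uf_orbit G q" unfolding uf_orbit_def using point_mult_one[OF q] one_closed by blast
    then have "q \<in> companion G q A" using qA unfolding companion_def by blast
    then obtain B where B: "B \<in> q" "beta_closure (carrier G) B \<inter> companion G q A = {q}"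
      using disp rem unfolding disparse_def discrete_in_beta_topology_iff[OF companion_subset_beta]
      by blast
    have AB: "A \<inter> B \<in> q" "B \<subseteq> carrier G"
      using ultrafilter_onD(1,4)[OF q] Aq B(1) by blast+
    \<comment> \<open>Only translates in \<open>A\<^sup>*\<close> belong to the companion, hence the intersection with \<open>A\<close>.\<close>
    have "g = \<one>" if "g \<in> hits q (A \<inter> B)" for g
    proof -
      have g: "g \<in> carrier G" "A \<in> point_mult g q" "B \<in> point_mult g q"
        using that hits_Int[OF q A AB(2)] mem_hits_iff[OF A] mem_hits_iff[OF AB(2)] by auto
      then have "point_mult g q \<in> beta_closure (carrier G) B \<inter> companion G q A"
        using point_mult_in_remainder[OF g(1) rem] ultrafilter_on_point_mult[OF g(1) q]
        unfolding companion_def uf_orbit_def beta_star_def beta_closure_def beta_def by blast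
      then show ?thesis using B(2) point_mult_free[OF g(1) q] by blast
    qed
    then have "hits q (A \<inter> B) = {\<one>}" using one_in_hits[OF q AB(1)] by blast
    then show "\<exists>B\<in>q. hits q B = {\<one>}" using AB(1) by blast
  qed
next
  assume iso: "\<forall>q\<in>beta_star (carrier G) A. \<exists>B\<in>q. hits q B = {\<one>}"
  show "disparse G A"
    unfolding disparse_def discrete_in_beta_topology_iff[OF companion_subset_beta]
  proof (intro ballI)
    fix p q assume p: "p \<in> beta_remainder (carrier G)" and qc: "q \<in> companion G p A"
    have up: "ultrafilter_on (carrier G) p" using p by (simp add: beta_remainder_def beta_def)
    obtain g where g: "g \<in> carrier G" "q = point_mult g p"
      using qc unfolding companion_def uf_orbit_def by blast
    have q: "ultrafilter_on (carrier G) q" using ultrafilter_on_point_mult[OF g(1) up] g(2) by simp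
    obtain B where B: "B \<in> q" "hits q B = {\<one>}"
      using iso qc unfolding companion_def by blast
    have Bsub: "B \<subseteq> carrier G" using ultrafilter_onD(1)[OF q B(1)] .
    have "r = q" if r: "r \<in> companion G p A" "B \<in> r" for r
    proof -
      obtain h where h: "h \<in> carrier G" "r = point_mult h p"
        using r(1) unfolding companion_def uf_orbit_def by blast
      then have r_eq: "r = point_mult (h \<otimes> inv g) q"
        using g point_mult_inv[OF g(1) up] by (metis inv_closed point_mult_point_mult)
      then have "h \<otimes> inv g \<in> hits q B" using r(2) h(1) g(1) by (simp add: mem_hits_iff[OF Bsub])
      then show ?thesis using r_eq B(2) point_mult_one[OF q] by simp
    qed
    then have "beta_closure (carrier G) B \<inter> companion G p A = {q}"
      using B(1) qc companion_subset_beta unfolding beta_closure_def by blast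
    then show "\<exists>B\<in>q. beta_closure (carrier G) B \<inter> companion G p A = {q}" using B(1) by blast
  qed
qed

end

theorem proposition9:
  fixes G :: "('a, 'b) monoid_scheme" and A :: "'a set"
  assumes "group G"
    and "countable (carrier G)"
    and "A \<subseteq> carrier G"
  shows "disparse G A \<longleftrightarrow>
    (\<forall>p \<in> beta_star (carrier G) A. right_cancelable (beta_monoid G) p)"
proof -
  interpret group G by fact
  have "ultrafilter_on (carrier G) p" if "p \<in> beta_star (carrier G) A" for p
    using that by (simp add: beta_star_def beta_closure_def beta_def)
  then show ?thesis
    using disparse_iff_hits[OF assms(3)] right_cancelable_iff_hits[OF assms(2)] by blast
qed

end
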